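(* (Greedy minibatches, smooth case.) Let $f:\mathbb{R}^n\to\mathbb{R}$ be differentiable and $\mathbf{M}$-smooth for a symmetric positive definite matrix $\mathbf{M}$, i.e. $f(\mathbf{x}+\mathbf{h})\le f(\mathbf{x})+\langle\nabla f(\mathbf{x}),\mathbf{h}\rangle+\frac12\langle\mathbf{M}\mathbf{h},\mathbf{h}\rangle$ for all $\mathbf{x},\mathbf{h}\in\mathbb{R}^n$, and let $f$ have a global minimizer $\mathbf{x}^*$. Put $\xi(\mathbf{x})=f(\mathbf{x})-f(\mathbf{x}^* )$ and $\mathcal{X}^*=\operatorname{argmin}f$. Fix $\tau\in\{1,\dots,n\}$ and $\mathbf{x}^0\in\mathbb{R}^n$, and for $k=0,\dots,K-1$ let $$S_k\in\operatorname*{argmax}_{S\subseteq[n],\,|S|=\tau}\ (\nabla_S f(\mathbf{x}^k))^\top(\mathbf{M}_S)^{-1}\nabla_S f(\mathbf{x}^k),$$ and let $\mathbf{x}^{k+1}$ be obtained from $\mathbf{x}^k$ by adding $-(\mathbf{M}_{S_k})^{-1}\nabla_{S_k}f(\mathbf{x}^k)$ to the coordinates in $S_k$ and leaving the other coordinates unchanged. Let $c:=\lambda_{\min}\big(\mathbf{E}[\mathbf{M}_{[S]}^{-1}]\big)$, where the expectation is over $S$ uniformly distributed on the subsets of $[n]$ of cardinality $\tau$, and let $\epsilon>0$. Then: (a) if $\mu>0$ and $\frac12\|\nabla f(\mathbf{x})\|^2\ge\mu\,\xi(\mathbf{x})$ for all $\mathbf{x}\in\mathbb{R}^n$, then $K\ge\frac{1}{\mu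 c}\log\left(\frac{\xi(\mathbf{x}^0)}{\epsilon}\right)$ implies $\xi(\mathbf{x}^K)\le\epsilon$; (b) if $\rho:\mathbb{R}^n\to(0,\infty)$ is such that $\frac{\|\nabla f(\mathbf{x})\|^2}{2\xi(\mathbf{x})}\ge\rho(\mathbf{y})\,\xi(\mathbf{x})$ for all $\mathbf{x},\mathbf{y}\in\mathbb{R}^n\setminus\mathcal{X}^*$ with $\xi(\mathbf{x})\le\xi(\mathbf{y})$, then $K\ge\frac{1}{\rho(\mathbf{x}^0)\,c\,\epsilon}$ implies $\xi(\mathbf{x}^K)\le\epsilon$; (c) with no further assumption on $f$, $K\ge\frac{\xi(\mathbf{x}^0)}{c\,\epsilon}\log\left(\frac{\xi(\mathbf{x}^0)}{\epsilon}\right)$ implies that $\xi(\mathbf{x}^K)\le\epsilon$ or there is $k\in\{0,\dots,K-1\}$ with $\frac12\|\nabla f(\mathbf{x}^k)\|^2\le\epsilon$.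
   Context: $[n]=\{1,\dots,n\}$; $\|\cdot\|$ is the Euclidean norm; $\lambda_{\min}$ is the smallest eigenvalue. For $\emptyset\neq S\subseteq[n]$, $\nabla_Sf(\mathbf{x})\in\mathbb{R}^{|S|}$ is the subvector of $\nabla f(\mathbf{x})$ with indices in $S$, $\mathbf{M}_S$ is the $|S|\times|S|$ principal submatrix of $\mathbf{M}$ with rows and columns in $S$, and $\mathbf{M}_{[S]}^{-1}$ denotes the $n\times n$ matrix having $(\mathbf{M}_S)^{-1}$ in the rows and columns indexed by $S$ and zeros elsewhere. Conventions: $\log0:=-\infty$, $0\log0:=0$. *)

theory Defs
  imports "HOL-Probability.Probability"
begin

text \<open>
  The coordinate set \<open>[n]\<close> is the universe of a finite index type \<open>'n\<close>, so \<open>n = CARD('n)\<close>.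
  Vectors and matrices whose entries are indexed by a subset \<open>S\<close> are functions that are
  extensional on \<open>S\<close> (and on \<open>S \<times> S\<close>, in curried form).
\<close>

definition gradient :: "('a::real_inner \<Rightarrow> real) \<Rightarrow> 'a \<Rightarrow> 'a" where
  "gradient f x = (THE D. GDERIV f x :> D)"

definition sym_pos_def :: "real^'n^'n \<Rightarrow> bool" where
  "sym_pos_def M \<longleftrightarrow> transpose M = M \<and> (\<forall>h. h \<noteq> 0 \<longrightarrow> (M *v h) \<bullet> h > 0)"

definition smooth_wrt :: "real^'n^'n \<Rightarrow> (real^'n \<Rightarrow> real) \<Rightarrow> bool" where
  "smooth_wrt M f \<longleftrightarrow>
     (\<forall>x h. f (x + h) \<le> f x + gradient f x \<bullet> h + (1/2) * ((M *v h) \<bullet> h))"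

definition argmin_set :: "('a \<Rightarrow> real) \<Rightarrow> 'a set" where
  "argmin_set f = {x. is_arg_min f (\<lambda>_. True) x}"

definition lambda_min :: "real^'n^'n \<Rightarrow> real" where
  "lambda_min A = Min {l. \<exists>v. v \<noteq> 0 \<and> A *v v = l *\<^sub>R v}"

definition subvec :: "'n set \<Rightarrow> real^'n \<Rightarrow> 'n \<Rightarrow> real" where
  "subvec S v = (\<lambda>i\<in>S. v $ i)"

definition submat :: "'n set \<Rightarrow> real^'n^'n \<Rightarrow> 'n \<Rightarrow> 'n \<Rightarrow> real" where
  "submat S M = (\<lambda>i\<in>S. \<lambda>j\<in>S. M $ i $ j)"

definition one_on :: "'i set \<Rightarrow> 'i \<Rightarrow> 'i \<Rightarrow> real" where
  "one_on S = (\<lambda>i\<in>S. \<lambda>j\<in>S. if i = j then 1 else 0)"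

definition mult_on :: "'i set \<Rightarrow> ('i \<Rightarrow> 'i \<Rightarrow> real) \<Rightarrow> ('i \<Rightarrow> 'i \<Rightarrow> real) \<Rightarrow> 'i \<Rightarrow> 'i \<Rightarrow> real" where
  "mult_on S A B = (\<lambda>i\<in>S. \<lambda>j\<in>S. \<Sum>k\<in>S. A i k * B k j)"

definition apply_on :: "'i set \<Rightarrow> ('i \<Rightarrow> 'i \<Rightarrow> real) \<Rightarrow> ('i \<Rightarrow> real) \<Rightarrow> 'i \<Rightarrow> real" where
  "apply_on S A v = (\<lambda>i\<in>S. \<Sum>j\<in>S. A i j * v j)"

definition inner_on :: "'i set \<Rightarrow> ('i \<Rightarrow> real) \<Rightarrow> ('i \<Rightarrow> real) \<Rightarrow> real" where
  "inner_on S u v = (\<Sum>i\<in>S. u i * v i)"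

text \<open>As for \<^const>\<open>matrix_inv\<close>, the value is unspecified if \<open>A\<close> has no inverse.\<close>

definition inv_on :: "'i set \<Rightarrow> ('i \<Rightarrow> 'i \<Rightarrow> real) \<Rightarrow> 'i \<Rightarrow> 'i \<Rightarrow> real" where
  "inv_on S A = (SOME B. B \<in> S \<rightarrow>\<^sub>E (S \<rightarrow>\<^sub>E UNIV) \<and>
                         mult_on S A B = one_on S \<and> mult_on S B A = one_on S)"

text \<open>The matrix written \<open>M\<close> with subscript \<open>[S]\<close> and exponent \<open>-1\<close>.\<close>

definition padded_inv :: "real^'n^'n \<Rightarrow> 'n set \<Rightarrow> real^'n^'n" where
  "padded_inv M S = (\<chi> i j. if i \<in> S \<and> j \<in> S then inv_on S (submat S M) i j else 0)"

definition add_on :: "'n set \<Rightarrow> real^'n \<Rightarrow> ('n \<Rightarrow> real) \<Rightarrow> real^'n" where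
  "add_on S x d = (\<chi> i. if i \<in> S then x $ i + d i else x $ i)"

definition block_score :: "real^'n^'n \<Rightarrow> (real^'n \<Rightarrow> real) \<Rightarrow> real^'n \<Rightarrow> 'n set \<Rightarrow> real" where
  "block_score M f x S =
     inner_on S (subvec S (gradient f x))
                (apply_on S (inv_on S (submat S M)) (subvec S (gradient f x)))"

definition block_step :: "real^'n^'n \<Rightarrow> (real^'n \<Rightarrow> real) \<Rightarrow> 'n set \<Rightarrow> real^'n \<Rightarrow> real^'n" where
  "block_step M f S x =
     add_on S x (\<lambda>i. - apply_on S (inv_on S (submat S M)) (subvec S (gradient f x)) i)"

definition uniform_mean_inv :: "real^'n^'n \<Rightarrow> nat \<Rightarrow> real^'n^'n" where
  "uniform_mean_inv M \<tau> =
     measure_pmf.expectation (pmf_of_set {S :: 'n set. card S = \<tau>}) (padded_inv M)"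

text \<open>
  The logarithm on \<open>[0, \<infinity>)\<close> with \<open>log 0 = -\<infinity>\<close>; the convention \<open>0 log 0 = 0\<close> is then part of
  the multiplication of \<^typ>\<open>ereal\<close>.  (The library's real \<^const>\<open>ln\<close> has \<open>ln 0 = 0\<close>.)
\<close>

definition elog :: "real \<Rightarrow> ereal" where
  "elog t = (if t = 0 then -\<infinity> else ereal (ln t))"

end

theory Submission
  imports Defs
begin

text \<open>
  With \<open>w = padded_inv M S *v g\<close>, the vector \<open>M *v w\<close> agrees with \<open>g\<close> on \<open>S\<close> and \<open>w\<close> is supported
  on \<open>S\<close>; hence \<open>w \<bullet> M w = g \<bullet> w\<close>, and \<open>M\<close>-smoothness makes a block step decrease \<open>f\<close> by half the
  block score \<open>g \<bullet> w\<close>.  The greedy score is at least the average score, and the latter is at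
  least \<open>c \<parallel>g\<parallel>\<^sup>2\<close> by the Rayleigh bound.  So \<open>\<xi> (x (k+1)) \<le> \<xi> (x k) - c \<parallel>\<nabla>f (x k)\<parallel>\<^sup>2 / 2\<close>, and the
  three claims are scalar recursions.
\<close>

section \<open>Symmetry of a matrix as self-adjointness for the inner product\<close>

lemma symmetric_matrix_inner:
  fixes A :: "real^'n^'n"
  assumes "transpose A = A"
  shows "u \<bullet> (A *v v) = (A *v u) \<bullet> v"
  using assms by (metis dot_lmul_matrix transpose_matrix_vector)

lemma symmetric_matrixI:
  fixes A :: "real^'n^'n"
  assumes "\<And>u v. u \<bullet> (A *v v) = (A *v u) \<bullet> v"
  shows "transpose A = A"
proof -
  have "transpose A *v u = A *v u" for u
    by (rule vector_eq_rdot[THEN iffD1])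
      (simp add: transpose_matrix_vector dot_lmul_matrix assms)
  then show ?thesis by (simp add: matrix_eq)
qed

subsection \<open>The smallest eigenvalue of a symmetric matrix\<close>

text \<open>Eigenvectors for distinct eigenvalues are orthogonal, so choosing one per eigenvalue
  gives an independent, hence finite, set. Finiteness is what gives the \<open>Min\<close> in
  \<open>lambda_min\<close> its meaning.\<close>

lemma symmetric_matrix_finite_eigenvalues:
  fixes A :: "real^'n^'n"
  assumes "transpose A = A"
  shows "finite {l. \<exists>v. v \<noteq> 0 \<and> A *v v = l *\<^sub>R v}" (is "finite ?E")
proof -
  obtain e where e: "\<And>l. l \<in> ?E \<Longrightarrow> e l \<noteq> 0 \<and> A *v e l = l *\<^sub>R e l"
    by atomize_elim (rule choice, blast)
  have orth: "e k \<bullet> e l = 0" if "k \<in> ?E" "l \<in> ?E" "k \<noteq> l" for k l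
  proof -
    have "l * (e k \<bullet> e l) = e k \<bullet> (A *v e l)" using e[OF that(2)] by simp
    also have "\<dots> = (A *v e k) \<bullet> e l" by (rule symmetric_matrix_inner[OF assms])
    also have "\<dots> = k * (e k \<bullet> e l)" using e[OF that(1)] by simp
    finally show ?thesis using that(3) by simp
  qed
  have "independent (e ` ?E)"
  proof (rule pairwise_orthogonal_independent)
    show "pairwise orthogonal (e ` ?E)"
      using orth by (auto simp: pairwise_image orthogonal_def pairwise_def)
    show "0 \<notin> e ` ?E" using e by force
  qed
  then have "finite (e ` ?E)" by (rule independent_imp_finite)
  moreover have "inj_on e ?E"
    using orth e by (metis (no_types, lifting) inj_onI inner_eq_zero_iff)
  ultimately show ?thesis by (rule finite_imageD)
qed

text \<open>Moving from \<open>v\<close> by \<open>- t *\<^sub>R (A *v v)\<close> changes the form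
  from 0 to \<open>- 2 * t * a + t\<^sup>2 * b\<close> with \<open>a\<close> the squared norm of
  \<open>A *v v\<close>; for small positive \<open>t\<close> this is negative unless
  \<open>a = 0\<close>.\<close>

lemma semidefinite_inner_zero:
  fixes A :: "real^'n^'n"
  assumes sym: "transpose A = A" and psd: "\<And>u. 0 \<le> u \<bullet> (A *v u)"
    and zero: "v \<bullet> (A *v v) = 0"
  shows "A *v v = 0"
proof -
  define w where "w = A *v v"
  define a where "a = w \<bullet> w"
  define b where "b = w \<bullet> (A *v w)"
  have b: "0 \<le> b" unfolding b_def by (rule psd)
  have vw: "v \<bullet> (A *v w) = a"
    by (simp add: symmetric_matrix_inner[OF sym] w_def a_def)
  have q: "0 \<le> - 2 * t * a + t\<^sup>2 * b" for t :: real
  proof -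
    have "0 \<le> (v - t *\<^sub>R w) \<bullet> (A *v (v - t *\<^sub>R w))" by (rule psd)
    also have "\<dots> = - 2 * t * a + t\<^sup>2 * b"
      using zero vw
      by (simp add: matrix_vector_mult_diff_distrib matrix_vector_mult_scaleR inner_diff
          flip: w_def a_def b_def)
        (simp add: power2_eq_square b_def a_def algebra_simps)
    finally show ?thesis .
  qed
  have a: "0 \<le> a" by (simp add: a_def)
  have "a \<le> 0"
  proof (rule ccontr)
    assume "\<not> a \<le> 0"
    then have "0 < a" by simp
    \<comment> \<open>The step size \<open>t = a / (b + 1)\<close> satisfies
      \<open>t * b \<le> a\<close>, so the linear term dominates; the summand 1 covers the case
      \<open>b = 0\<close>.\<close>
    then have "0 < a / (b + 1)" using b by simp
    have "0 \<le> (a / (b + 1)) * (- 2 * a + (a / (b + 1)) * b)"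
      using q[of "a / (b + 1)"] by (simp add: power2_eq_square algebra_simps)
    then have "0 \<le> - 2 * a + (a / (b + 1)) * b"
      using \<open>0 < a / (b + 1)\<close> unfolding zero_le_mult_iff by linarith
    moreover have "(a / (b + 1)) * b \<le> a"
      using b \<open>0 < a\<close> by (simp add: field_simps)
    ultimately show False using \<open>0 < a\<close> by simp
  qed
  then have "w = 0" using a unfolding a_def by (metis antisym inner_eq_zero_iff)
  then show ?thesis by (simp add: w_def)
qed

text \<open>By compactness the quadratic form attains its minimum \<open>l\<close> on the unit
  sphere. Then \<open>A - l *\<^sub>R mat 1\<close> is positive semidefinite with form 0 at the
  minimizer, which is therefore an eigenvector.\<close>

lemma symmetric_matrix_least_eigenvalue:
  fixes A :: "real^'n^'n"
  assumes sym: "transpose A = A"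
  obtains l v where "v \<noteq> 0" "A *v v = l *\<^sub>R v" "\<And>u. l * (u \<bullet> u) \<le> u \<bullet> (A *v u)"
proof -
  have "sphere (0 :: real^'n) 1 \<noteq> {}" by simp
  moreover have "continuous_on (sphere 0 1) (\<lambda>u :: real^'n. u \<bullet> (A *v u))"
    by (intro continuous_intros linear_continuous_on matrix_vector_mul_bounded_linear)
  ultimately obtain v :: "real^'n" where v: "norm v = 1"
    and min: "\<And>u. norm u = 1 \<Longrightarrow> v \<bullet> (A *v v) \<le> u \<bullet> (A *v u)"
    using continuous_attains_inf[OF compact_sphere, of 0 1 "\<lambda>u :: real^'n. u \<bullet> (A *v u)"]
    by auto
  define l where "l = v \<bullet> (A *v v)"
  have ray: "l * (u \<bullet> u) \<le> u \<bullet> (A *v u)" for u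
  proof (cases "u = 0")
    case False
    have "l \<le> (u /\<^sub>R norm u) \<bullet> (A *v (u /\<^sub>R norm u))"
      unfolding l_def using False by (intro min) simp
    also have "\<dots> = (u \<bullet> (A *v u)) / (u \<bullet> u)"
      by (simp add: matrix_vector_mult_scaleR dot_square_norm power2_eq_square divide_simps)
    finally show ?thesis using False by (simp add: pos_le_divide_eq)
  qed simp
  define B where "B = A - l *\<^sub>R mat 1"
  have B: "B *v u = A *v u - l *\<^sub>R u" for u
    by (simp add: B_def matrix_vector_mult_diff_rdistrib scaleR_matrix_vector_assoc[symmetric])
  have "B *v v = 0"
  proof (rule semidefinite_inner_zero)
    show "transpose B = B"
      by (rule symmetric_matrixI)
        (simp add: B inner_diff symmetric_matrix_inner[OF sym])
    show "0 \<le> u \<bullet> (B *v u)" for u using ray[of u] by (simp add: B inner_diff)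
    show "v \<bullet> (B *v v) = 0" using v by (simp add: B inner_diff l_def dot_square_norm)
  qed
  then show ?thesis using v ray by (intro that[of v l]) (auto simp: B)
qed

lemma
  fixes A :: "real^'n^'n"
  assumes sym: "transpose A = A"
  shows lambda_min_eigenvalue: "\<exists>v. v \<noteq> 0 \<and> A *v v = lambda_min A *\<^sub>R v"
    and lambda_min_rayleigh: "lambda_min A * (u \<bullet> u) \<le> u \<bullet> (A *v u)"
proof -
  obtain l v where l: "v \<noteq> 0" "A *v v = l *\<^sub>R v" "\<And>u. l * (u \<bullet> u) \<le> u \<bullet> (A *v u)"
    using symmetric_matrix_least_eigenvalue[OF sym] by blast
  have "lambda_min A = l"
    unfolding lambda_min_def
  proof (rule Min_eqI)
    show "finite {l. \<exists>v. v \<noteq> 0 \<and> A *v v = l *\<^sub>R v}"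
      by (rule symmetric_matrix_finite_eigenvalues[OF sym])
    show "l \<in> {l. \<exists>v. v \<noteq> 0 \<and> A *v v = l *\<^sub>R v}" using l by blast
    fix k assume "k \<in> {l. \<exists>v. v \<noteq> 0 \<and> A *v v = l *\<^sub>R v}"
    then obtain u where u: "u \<noteq> 0" "A *v u = k *\<^sub>R u" by blast
    show "l \<le> k" using l(3)[of u] u by simp
  qed
  then show "\<exists>v. v \<noteq> 0 \<and> A *v v = lambda_min A *\<^sub>R v"
    and "lambda_min A * (u \<bullet> u) \<le> u \<bullet> (A *v u)"
    using l by blast+
qed

subsection \<open>Principal submatrices of a positive definite matrix\<close>

lemma sym_pos_def_invertible:
  fixes M :: "real^'n^'n"
  assumes "sym_pos_def M"
  shows "invertible M"
proof -
  have "u = 0" if "M *v u = 0" for u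
    using assms that by (metis inner_zero_left less_irrefl sym_pos_def_def)
  then show ?thesis
    by (metis invertible_left_inverse matrix_left_invertible_ker)
qed

text \<open>Since \<open>inv_on\<close> is a choice, a two-sided inverse has to be exhibited; it
  exists because positive definiteness passes to principal submatrices.\<close>

lemma mult_on_inv_on:
  fixes M :: "real^'n^'n"
  assumes "sym_pos_def M"
  shows "mult_on S (submat S M) (inv_on S (submat S M)) = one_on S"
proof -
  \<comment> \<open>pad the submatrix with the identity so that it can be inverted as a full matrix\<close>
  define N :: "real^'n^'n" where
    "N = (\<chi> i j. if i \<in> S \<and> j \<in> S then M $ i $ j else if i = j then 1 else 0)"
  have pd: "(N *v h) \<bullet> h > 0" if "h \<noteq> 0" for h
  proof -
    \<comment> \<open>\<open>h\<close> splits into its parts on and off \<open>S\<close>;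
      \<open>N\<close> is block diagonal, so its form is that of \<open>M\<close> at
      \<open>p\<close> plus the squared norm of \<open>r\<close>.\<close>
    define p :: "real^'n" where "p = (\<chi> i. if i \<in> S then h $ i else 0)"
    define r :: "real^'n" where "r = (\<chi> i. if i \<in> S then 0 else h $ i)"
    have "(N *v h) $ i = (if i \<in> S then (M *v p) $ i else r $ i)" for i
    proof (cases "i \<in> S")
      case True
      then show ?thesis
        by (auto simp: N_def p_def matrix_vector_mult_def intro!: sum.cong)
    next
      case False
      then have "(N *v h) $ i = (\<Sum>j\<in>UNIV. if i = j then h $ j else 0)"
        by (auto simp: matrix_vector_mult_def N_def simp del: sum.delta sum.delta' intro!: sum.cong)
      then show ?thesis using False by (simp add: r_def)
    qed
    then have "(N *v h) \<bullet> h = (\<Sum>i\<in>UNIV. (M *v p) $ i * p $ i + r $ i * r $ i)"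
      unfolding inner_vec_def by (intro sum.cong) (auto simp: p_def r_def)
    then have eq: "(N *v h) \<bullet> h = (M *v p) \<bullet> p + r \<bullet> r"
      by (simp add: inner_vec_def sum.distrib)
    have "p \<noteq> 0 \<or> r \<noteq> 0"
    proof -
      have "h = p + r" by (simp add: vec_eq_iff p_def r_def)
      then show ?thesis using that by auto
    qed
    moreover have "p \<noteq> 0 \<Longrightarrow> (M *v p) \<bullet> p > 0" using assms by (simp add: sym_pos_def_def)
    ultimately show ?thesis
      unfolding eq by (cases "p = 0") (auto intro: add_pos_nonneg)
  qed
  have "transpose M = M" using assms by (simp add: sym_pos_def_def)
  then have "M $ i $ j = M $ j $ i" for i j by (metis transpose_def vec_lambda_beta)
  then have "transpose N = N" by (simp add: vec_eq_iff transpose_def N_def)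
  with pd have "sym_pos_def N" by (simp add: sym_pos_def_def)
  then obtain N' where N': "N ** N' = mat 1" "N' ** N = mat 1"
    using sym_pos_def_invertible unfolding invertible_def by blast
  \<comment> \<open>The \<open>S\<close> block of \<open>N'\<close> inverts that of
    \<open>N\<close>: the entries of \<open>N\<close> linking \<open>S\<close> to its complement
    vanish, so the sums over \<open>UNIV\<close> below reduce to sums over \<open>S\<close>.\<close>
  define B where "B = (\<lambda>i\<in>S. \<lambda>j\<in>S. N' $ i $ j)"
  have "(\<Sum>k\<in>S. submat S M i k * B k j) = (if i = j then 1 else 0)"
    if "i \<in> S" "j \<in> S" for i j
  proof -
    have "(\<Sum>k\<in>S. submat S M i k * B k j) = (\<Sum>k\<in>UNIV. N $ i $ k * N' $ k $ j)"
      using that by (intro sum.mono_neutral_cong_left) (auto simp: submat_def B_def N_def)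
    also have "\<dots> = (N ** N') $ i $ j" by (simp add: matrix_matrix_mult_def)
    finally show ?thesis by (simp add: N' mat_def)
  qed
  then have "mult_on S (submat S M) B = one_on S"
    by (auto simp: mult_on_def one_on_def fun_eq_iff restrict_def)
  moreover have "(\<Sum>k\<in>S. B i k * submat S M k j) = (if i = j then 1 else 0)"
    if "i \<in> S" "j \<in> S" for i j
  proof -
    have "(\<Sum>k\<in>S. B i k * submat S M k j) = (\<Sum>k\<in>UNIV. N' $ i $ k * N $ k $ j)"
      using that by (intro sum.mono_neutral_cong_left) (auto simp: submat_def B_def N_def)
    also have "\<dots> = (N' ** N) $ i $ j" by (simp add: matrix_matrix_mult_def)
    finally show ?thesis by (simp add: N' mat_def)
  qed
  then have "mult_on S B (submat S M) = one_on S"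
    by (auto simp: mult_on_def one_on_def fun_eq_iff restrict_def)
  moreover have "B \<in> S \<rightarrow>\<^sub>E (S \<rightarrow>\<^sub>E UNIV)" by (auto simp: B_def)
  ultimately have "\<exists>B. B \<in> S \<rightarrow>\<^sub>E (S \<rightarrow>\<^sub>E UNIV) \<and> mult_on S (submat S M) B = one_on S \<and>
      mult_on S B (submat S M) = one_on S"
    by blast
  from someI_ex[OF this] show ?thesis unfolding inv_on_def by blast
qed

lemma padded_inv_nth:
  fixes v :: "real^'n"
  shows "(padded_inv M S *v v) $ i =
    (if i \<in> S then apply_on S (inv_on S (submat S M)) (subvec S v) i else 0)"
proof (cases "i \<in> S")
  case True
  have "(\<Sum>j\<in>UNIV. padded_inv M S $ i $ j * v $ j) =
      (\<Sum>j\<in>S. inv_on S (submat S M) i j * subvec S v j)"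
    using True
    by (intro sum.mono_neutral_cong_right) (auto simp: padded_inv_def subvec_def)
  then show ?thesis using True by (simp add: matrix_vector_mult_def apply_on_def)
qed (simp add: matrix_vector_mult_def padded_inv_def)

text \<open>The inner product vector is supported on \<open>S\<close>, so row \<open>i\<close> of
  \<open>M\<close> meets it only through the block of \<open>S\<close>, which cancels its
  inverse.\<close>

lemma mult_padded_inv_nth:
  fixes M :: "real^'n^'n"
  assumes "sym_pos_def M" and "i \<in> S"
  shows "(M *v (padded_inv M S *v v)) $ i = v $ i"
proof -
  define B where "B = inv_on S (submat S M)"
  have "(\<Sum>k\<in>S. M $ i $ k * B k j) = (if i = j then 1 else 0)" if "j \<in> S" for j
  proof -
    have "mult_on S (submat S M) B i j = one_on S i j"
      using mult_on_inv_on[OF assms(1)] by (simp add: B_def)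
    then show ?thesis using assms(2) that
      by (simp add: mult_on_def one_on_def submat_def)
  qed
  note inv = this
  have "(M *v (padded_inv M S *v v)) $ i = (\<Sum>k\<in>S. M $ i $ k * (\<Sum>j\<in>S. B k j * v $ j))"
    unfolding matrix_vector_mult_def[of M] vec_lambda_beta padded_inv_nth
    by (intro trans[OF sum.mono_neutral_cong_right[of UNIV S]])
      (auto simp: apply_on_def subvec_def B_def)
  also have "\<dots> = (\<Sum>j\<in>S. (\<Sum>k\<in>S. M $ i $ k * B k j) * v $ j)"
    by (simp add: sum_distrib_left sum_distrib_right mult.assoc) (rule sum.swap)
  also have "\<dots> = (\<Sum>j\<in>S. if i = j then v $ j else 0)"
    by (intro sum.cong) (auto simp: inv)
  also have "\<dots> = v $ i" using assms(2) by simp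
  finally show ?thesis .
qed

text \<open>The left factors agree on \<open>S\<close>, and the common right factor vanishes off
  \<open>S\<close>. Symmetry and positivity of the padded inverse are thereby inherited from
  \<open>M\<close>.\<close>

lemma inner_padded_inv:
  fixes M :: "real^'n^'n"
  assumes "sym_pos_def M"
  shows "u \<bullet> (padded_inv M S *v v) = (M *v (padded_inv M S *v u)) \<bullet> (padded_inv M S *v v)"
  unfolding inner_vec_def
proof (rule sum.cong)
  fix i
  show "u $ i \<bullet> (padded_inv M S *v v) $ i =
      (M *v (padded_inv M S *v u)) $ i \<bullet> (padded_inv M S *v v) $ i"
    using mult_padded_inv_nth[OF assms, of i S u] by (cases "i \<in> S") (auto simp: padded_inv_nth)
qed simp

lemma padded_inv_selfadjoint:
  fixes M :: "real^'n^'n"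
  assumes "sym_pos_def M"
  shows "u \<bullet> (padded_inv M S *v v) = (padded_inv M S *v u) \<bullet> v"
  using assms
  by (metis inner_padded_inv inner_commute symmetric_matrix_inner sym_pos_def_def)

lemma padded_inv_nonneg:
  fixes M :: "real^'n^'n"
  assumes "sym_pos_def M"
  shows "0 \<le> v \<bullet> (padded_inv M S *v v)"
  by (subst inner_padded_inv[OF assms])
    (metis assms sym_pos_def_def inner_zero_right less_eq_real_def)

lemma padded_inv_pos:
  fixes M :: "real^'n^'n"
  assumes "sym_pos_def M" and "i \<in> S" and "v $ i \<noteq> 0"
  shows "0 < v \<bullet> (padded_inv M S *v v)"
proof -
  have "padded_inv M S *v v \<noteq> 0"
    using mult_padded_inv_nth[OF assms(1,2), of v] assms(3) by auto
  then show ?thesis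
    using assms(1) by (subst inner_padded_inv[OF assms(1)]) (simp add: sym_pos_def_def)
qed

section \<open>One block step in terms of the padded inverse\<close>

lemma block_score_eq: "block_score M f x S = gradient f x \<bullet> (padded_inv M S *v gradient f x)"
  unfolding block_score_def inner_on_def inner_vec_def
  by (intro sum.mono_neutral_cong_left) (auto simp: padded_inv_nth subvec_def)

lemma block_step_eq: "block_step M f S x = x - padded_inv M S *v gradient f x"
  by (simp add: block_step_def add_on_def vec_eq_iff padded_inv_nth)

lemma block_step_decrease:
  assumes "sym_pos_def M" and "smooth_wrt M f"
  shows "f (block_step M f S x) \<le> f x - block_score M f x S / 2"
proof -
  define w where "w = padded_inv M S *v gradient f x"
  have "f (x + (- w)) \<le> f x + gradient f x \<bullet> (- w) + (1/2) * ((M *v (- w)) \<bullet> (- w))"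
    using assms(2) unfolding smooth_wrt_def by blast
  moreover have "M *v (- w) = - (M *v w)"
    using matrix_vector_mult_diff_distrib[of M 0 w] by simp
  moreover have "(M *v w) \<bullet> w = gradient f x \<bullet> w"
    unfolding w_def by (rule inner_padded_inv[OF assms(1), symmetric])
  ultimately show ?thesis
    by (simp add: block_step_eq block_score_eq flip: w_def)
qed

subsection \<open>The averaged inverse\<close>

lemma ex_card_superset_singleton:
  fixes i :: "'n::finite"
  assumes "\<tau> \<in> {1..CARD('n)}"
  obtains T where "card T = \<tau>" "i \<in> T"
proof -
  obtain T where "{i} \<subseteq> T" "card T = \<tau>"
    using exists_subset_between[of "{i}" \<tau> UNIV] assms by auto
  then show ?thesis using that by blast
qed

text \<open>The expectation is a finite average, through which the bilinear form passes.\<close>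

lemma inner_uniform_mean_inv:
  fixes M :: "real^'n^'n"
  assumes "\<tau> \<in> {1..CARD('n)}"
  shows "u \<bullet> (uniform_mean_inv M \<tau> *v v) =
    (\<Sum>T | card T = \<tau>. u \<bullet> (padded_inv M T *v v)) / card {T :: 'n set. card T = \<tau>}"
proof -
  let ?C = "{T :: 'n set. card T = \<tau>}"
  have ne: "?C \<noteq> {}" using ex_card_superset_singleton[OF assms] by blast
  have "uniform_mean_inv M \<tau> = (\<Sum>T\<in>?C. pmf (pmf_of_set ?C) T *\<^sub>R padded_inv M T)"
    unfolding uniform_mean_inv_def
    by (rule integral_measure_pmf) (use ne in \<open>auto simp: set_pmf_of_set\<close>)
  also have "\<dots> = (1 / card ?C) *\<^sub>R (\<Sum>T\<in>?C. padded_inv M T)"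
    using ne by (simp add: scaleR_sum_right pmf_of_set)
  finally have E: "uniform_mean_inv M \<tau> = (1 / card ?C) *\<^sub>R (\<Sum>T\<in>?C. padded_inv M T)" .
  have "(\<Sum>T\<in>?C. padded_inv M T) *v v = (\<Sum>T\<in>?C. padded_inv M T *v v)"
    by (induction rule: infinite_finite_induct)
      (simp_all add: matrix_vector_mult_add_rdistrib)
  then show ?thesis
    by (simp add: E inner_sum_right flip: scaleR_matrix_vector_assoc)
qed

lemma uniform_mean_inv_symmetric:
  fixes M :: "real^'n^'n"
  assumes "sym_pos_def M" and "\<tau> \<in> {1..CARD('n)}"
  shows "transpose (uniform_mean_inv M \<tau>) = uniform_mean_inv M \<tau>"
proof (rule symmetric_matrixI)
  fix u v :: "real^'n"
  have "u \<bullet> (padded_inv M T *v v) = v \<bullet> (padded_inv M T *v u)" for T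
    unfolding padded_inv_selfadjoint[OF assms(1), of u] by (rule inner_commute)
  then have "u \<bullet> (uniform_mean_inv M \<tau> *v v) = v \<bullet> (uniform_mean_inv M \<tau> *v u)"
    by (simp add: inner_uniform_mean_inv[OF assms(2)])
  then show "u \<bullet> (uniform_mean_inv M \<tau> *v v) = (uniform_mean_inv M \<tau> *v u) \<bullet> v"
    by (simp only: inner_commute)
qed

text \<open>At an eigenvector for the least eigenvalue every block contributes a nonnegative term,
  and a block containing a nonzero coordinate contributes a positive one. Such a block exists
  because \<open>\<tau>\<close> is at least 1.\<close>

lemma lambda_min_uniform_mean_inv_pos:
  fixes M :: "real^'n^'n"
  assumes M: "sym_pos_def M" and \<tau>: "\<tau> \<in> {1..CARD('n)}"
  shows "0 < lambda_min (uniform_mean_inv M \<tau>)"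
proof -
  let ?C = "{T :: 'n set. card T = \<tau>}"
  obtain v where v: "v \<noteq> 0"
      "uniform_mean_inv M \<tau> *v v = lambda_min (uniform_mean_inv M \<tau>) *\<^sub>R v"
    using lambda_min_eigenvalue[OF uniform_mean_inv_symmetric[OF M \<tau>]] by blast
  obtain i where i: "v $ i \<noteq> 0" using v(1) by (auto simp: vec_eq_iff)
  obtain T where T: "card T = \<tau>" "i \<in> T" using ex_card_superset_singleton[OF \<tau>] .
  have "0 < (\<Sum>T\<in>?C. v \<bullet> (padded_inv M T *v v))"
    using T padded_inv_pos[OF M T(2) i]
    by (intro sum_pos2[of _ T]) (auto intro: padded_inv_nonneg[OF M])
  moreover have "0 < card ?C" using T by (auto simp: card_gt_0_iff)
  ultimately have "0 < v \<bullet> (uniform_mean_inv M \<tau> *v v)"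
    by (simp add: inner_uniform_mean_inv[OF \<tau>])
  then show ?thesis
    using v inner_ge_zero[of v] by (simp add: zero_less_mult_iff del: inner_ge_zero)
qed

text \<open>A maximum is at least the average, and the average score is the quadratic form of the
  mean inverse at the gradient.\<close>

lemma greedy_block_score_ge:
  fixes M :: "real^'n^'n"
  assumes M: "sym_pos_def M" and \<tau>: "\<tau> \<in> {1..CARD('n)}"
    and S: "is_arg_max (block_score M f x) (\<lambda>T. card T = \<tau>) S"
  shows "lambda_min (uniform_mean_inv M \<tau>) * (norm (gradient f x))\<^sup>2 \<le> block_score M f x S"
proof -
  let ?C = "{T :: 'n set. card T = \<tau>}"
  have "card ?C > 0" using S by (auto simp: card_gt_0_iff is_arg_max_def)
  have "(\<Sum>T\<in>?C. block_score M f x T) \<le> (\<Sum>T\<in>?C. block_score M f x S)"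
    using S by (intro sum_mono) (auto simp: is_arg_max_def not_less)
  then have "(\<Sum>T\<in>?C. block_score M f x T) / card ?C \<le> block_score M f x S"
    using \<open>card ?C > 0\<close> by (simp add: pos_divide_le_eq mult.commute)
  then show ?thesis
    using lambda_min_rayleigh[OF uniform_mean_inv_symmetric[OF M \<tau>], of "gradient f x"]
    by (simp add: inner_uniform_mean_inv[OF \<tau>] block_score_eq dot_square_norm)
qed

subsection \<open>Scalar recursions\<close>

text \<open>Iterating \<open>1 - q \<le> exp (- q)\<close> bounds \<open>e k\<close> by
  \<open>exp (- (real k * q)) * e 0\<close>. Parts (a) and (c) both reduce to this.\<close>

lemma contraction_rate:
  fixes e :: "nat \<Rightarrow> real"
  assumes step: "\<And>k. k < K \<Longrightarrow> e (Suc k) \<le> (1 - q) * e k"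
    and nonneg: "\<And>k. k \<le> K \<Longrightarrow> 0 \<le> e k"
    and "0 < q" "0 < \<epsilon>"
    and K: "ereal (real K) \<ge> ereal (1 / q) * elog (e 0 / \<epsilon>)"
  shows "e K \<le> \<epsilon>"
proof -
  have bound: "k \<le> K \<Longrightarrow> e k \<le> exp (- (real k * q)) * e 0" for k
  proof (induction k)
    case (Suc k)
    have "e (Suc k) \<le> (1 - q) * e k" using Suc.prems by (intro step) simp
    also have "\<dots> \<le> exp (- q) * e k"
      using Suc.prems exp_ge_add_one_self[of "- q"] by (intro mult_right_mono nonneg) auto
    also have "\<dots> \<le> exp (- q) * (exp (- (real k * q)) * e 0)"
      using Suc by (intro mult_left_mono) auto
    finally show ?case by (simp add: algebra_simps flip: exp_add)
  qed simp
  show ?thesis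
  \<comment> \<open>Here \<open>elog\<close> is minus infinity and the bound on \<open>K\<close>
    carries no information, but the exponential bound already gives
    \<open>e K \<le> 0\<close>.\<close>
  proof (cases "e 0 = 0")
    case True
    then show ?thesis using bound[of K] \<open>0 < \<epsilon>\<close> by simp
  next
    case False
    then have e0: "0 < e 0" using nonneg[of 0] by simp
    have "ln (e 0 / \<epsilon>) / q \<le> real K"
      using K e0 \<open>0 < \<epsilon>\<close> by (simp add: elog_def)
    then have "ln (e 0 / \<epsilon>) \<le> real K * q" using \<open>0 < q\<close> by (simp add: pos_divide_le_eq)
    then have "e 0 / \<epsilon> \<le> exp (real K * q)"
      using e0 \<open>0 < \<epsilon>\<close> by (metis divide_pos_pos exp_le_cancel_iff exp_ln)
    then have "exp (- (real K * q)) * e 0 \<le> \<epsilon>"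
      using \<open>0 < \<epsilon>\<close> by (simp add: exp_minus field_simps)
    then show ?thesis using bound[of K] by simp
  qed
qed

text \<open>Reciprocals grow by at least \<open>q\<close> per step: \<open>e k - e (Suc k)\<close>
  is at least \<open>q * e k * e (Suc k)\<close>, and dividing by \<open>e k * e (Suc k)\<close>
  telescopes.\<close>

lemma quadratic_recursion_rate:
  fixes e :: "nat \<Rightarrow> real"
  assumes step: "\<And>k. k < K \<Longrightarrow> e (Suc k) \<le> e k - q * (e k)\<^sup>2"
    and pos: "\<And>k. k \<le> K \<Longrightarrow> 0 < e k"
    and "0 < q" "0 < \<epsilon>"
    and K: "real K \<ge> 1 / (q * \<epsilon>)"
  shows "e K \<le> \<epsilon>"
proof -
  have bound: "k \<le> K \<Longrightarrow> 1 / e 0 + real k * q \<le> 1 / e k" for k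
  proof (induction k)
    case (Suc k)
    have e: "0 < e k" "0 < e (Suc k)" using Suc.prems by (auto intro: pos)
    have s: "e (Suc k) \<le> e k - q * (e k)\<^sup>2" using Suc.prems by (intro step) simp
    then have "e (Suc k) \<le> e k" using \<open>0 < q\<close> by (smt (verit) mult_nonneg_nonneg zero_le_power2)
    then have "q * e k * e (Suc k) \<le> q * e k * e k"
      using e \<open>0 < q\<close> by (intro mult_left_mono) auto
    then have "q * e k * e (Suc k) \<le> e k - e (Suc k)" using s by (simp add: power2_eq_square)
    then have "1 / e k + q \<le> 1 / e (Suc k)" using e by (simp add: field_simps)
    then show ?case using Suc by (simp add: algebra_simps)
  qed simp
  have "1 / \<epsilon> \<le> real K * q" using K \<open>0 < q\<close> \<open>0 < \<epsilon>\<close> by (simp add: field_simps)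
  also have "\<dots> \<le> 1 / e K" using bound[of K] pos[of 0] by (smt (verit) divide_pos_pos order_refl zero_le)
  finally show ?thesis using pos[of K] \<open>0 < \<epsilon>\<close> by (simp add: field_simps)
qed

section \<open>Decrease along the greedy iterates and the three rates\<close>

theorem mainTheorem5:
  fixes f :: "real^'n \<Rightarrow> real" and M :: "real^'n^'n"
    and xstar x0 :: "real^'n" and \<xi> :: "real^'n \<Rightarrow> real"
    and \<tau> K :: nat and x :: "nat \<Rightarrow> real^'n" and S :: "nat \<Rightarrow> 'n set"
    and c \<epsilon> :: real
  assumes "sym_pos_def M"
    and "f differentiable_on UNIV"
    and "smooth_wrt M f"
    and "xstar \<in> argmin_set f"
    and "\<xi> = (\<lambda>z. f z - f xstar)"
    and "\<tau> \<in> {1..CARD('n)}"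
    and "x 0 = x0"
    and "\<And>k. k < K \<Longrightarrow> is_arg_max (block_score M f (x k)) (\<lambda>T. card T = \<tau>) (S k)"
    and "\<And>k. k < K \<Longrightarrow> x (Suc k) = block_step M f (S k) (x k)"
    and "c = lambda_min (uniform_mean_inv M \<tau>)"
    and "\<epsilon> > 0"
  shows
    "(\<forall>\<mu>::real. \<mu> > 0 \<and> (\<forall>z. (1/2) * (norm (gradient f z))\<^sup>2 \<ge> \<mu> * \<xi> z) \<longrightarrow>
        ereal (real K) \<ge> ereal (1 / (\<mu> * c)) * elog (\<xi> x0 / \<epsilon>) \<longrightarrow>
        \<xi> (x K) \<le> \<epsilon>)
     \<and>
     (\<forall>\<rho> :: real^'n \<Rightarrow> real.
        (\<forall>z. \<rho> z > 0) \<and>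
        (\<forall>z y. z \<in> UNIV - argmin_set f \<and> y \<in> UNIV - argmin_set f \<and> \<xi> z \<le> \<xi> y \<longrightarrow>
           (norm (gradient f z))\<^sup>2 / (2 * \<xi> z) \<ge> \<rho> y * \<xi> z) \<longrightarrow>
        real K \<ge> 1 / (\<rho> x0 * c * \<epsilon>) \<longrightarrow>
        \<xi> (x K) \<le> \<epsilon>)
     \<and>
     (ereal (real K) \<ge> ereal (\<xi> x0 / (c * \<epsilon>)) * elog (\<xi> x0 / \<epsilon>) \<longrightarrow>
        \<xi> (x K) \<le> \<epsilon> \<or> (\<exists>k<K. (1/2) * (norm (gradient f (x k)))\<^sup>2 \<le> \<epsilon>))"
proof -
  note M = assms(1) and \<tau> = assms(6)
  have c: "0 < c" unfolding assms(10) by (rule lambda_min_uniform_mean_inv_pos[OF M \<tau>])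
  have nonneg: "0 \<le> \<xi> z" for z
    using assms(4) by (auto simp: assms(5) argmin_set_def is_arg_min_def not_less)
  have argmin: "\<xi> z = 0" if "z \<in> argmin_set f" for z
    using that assms(4) unfolding assms(5) argmin_set_def is_arg_min_def
    by (simp add: not_less eq_iff)
  have dec: "\<xi> (x (Suc k)) \<le> \<xi> (x k) - c * ((1/2) * (norm (gradient f (x k)))\<^sup>2)" if "k < K" for k
    using block_step_decrease[OF M assms(3), of "S k" "x k"]
      greedy_block_score_ge[OF M \<tau> assms(8)[OF that]]
    by (simp add: assms(5) assms(9)[OF that] flip: assms(10))
  have mono1: "\<xi> (x (Suc k)) \<le> \<xi> (x k)" if "k < K" for k
  proof -
    have "0 \<le> c * ((1/2) * (norm (gradient f (x k)))\<^sup>2)" using c by simp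
    then show ?thesis using dec[OF that] by linarith
  qed
  have mono: "\<xi> (x k) \<le> \<xi> (x j)" if "j \<le> k" "k \<le> K" for j k
    using that
  proof (induction rule: dec_induct)
    case (step k)
    then show ?case using mono1[of k] by simp
  qed simp
  have a: "\<xi> (x K) \<le> \<epsilon>"
    if \<mu>: "\<mu> > 0" "\<And>z. (1/2) * (norm (gradient f z))\<^sup>2 \<ge> \<mu> * \<xi> z"
      and K: "ereal (real K) \<ge> ereal (1 / (\<mu> * c)) * elog (\<xi> x0 / \<epsilon>)" for \<mu>
  proof (rule contraction_rate[where q = "\<mu> * c" and e = "\<lambda>k. \<xi> (x k)"])
    fix k assume "k < K"
    have "c * (\<mu> * \<xi> (x k)) \<le> c * ((1/2) * (norm (gradient f (x k)))\<^sup>2)"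
      using c by (intro mult_left_mono \<mu>) simp
    moreover have "(1 - \<mu> * c) * \<xi> (x k) = \<xi> (x k) - c * (\<mu> * \<xi> (x k))"
      by (simp add: algebra_simps)
    ultimately show "\<xi> (x (Suc k)) \<le> (1 - \<mu> * c) * \<xi> (x k)"
      using dec[OF \<open>k < K\<close>] by linarith
  qed (use \<mu> c nonneg K assms(7,11) in auto)
  have b: "\<xi> (x K) \<le> \<epsilon>"
    if \<rho>: "\<And>z. \<rho> z > 0"
      and gd: "\<And>z y. z \<notin> argmin_set f \<Longrightarrow> y \<notin> argmin_set f \<Longrightarrow> \<xi> z \<le> \<xi> y \<Longrightarrow>
        (norm (gradient f z))\<^sup>2 / (2 * \<xi> z) \<ge> \<rho> y * \<xi> z"
      and K: "real K \<ge> 1 / (\<rho> x0 * c * \<epsilon>)" for \<rho>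
  \<comment> \<open>Unless the last gap is zero, monotonicity makes all earlier gaps positive, as
    the passage to reciprocals requires.\<close>
  proof (cases "\<xi> (x K) = 0")
    case False
    then have pos: "0 < \<xi> (x k)" if "k \<le> K" for k
      using nonneg[of "x K"] mono[OF that] by simp
    show ?thesis
    proof (rule quadratic_recursion_rate[where q = "\<rho> x0 * c" and e = "\<lambda>k. \<xi> (x k)"])
      fix k assume k: "k < K"
      have p: "0 < \<xi> (x k)" using k by (intro pos) simp
      \<comment> \<open>Taking \<open>y = x0\<close> gives one constant for all \<open>k\<close>;
        this is allowed since the gap never exceeds its initial value. Positive gaps keep both
        points outside \<open>argmin_set f\<close>.\<close>
      have "\<rho> x0 * \<xi> (x k) \<le> (norm (gradient f (x k)))\<^sup>2 / (2 * \<xi> (x k))"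
        using k p pos[of 0] mono[of 0 k] assms(7) argmin[of "x k"] argmin[of x0]
        by (intro gd) auto
      then have "\<rho> x0 * (\<xi> (x k))\<^sup>2 \<le> (1/2) * (norm (gradient f (x k)))\<^sup>2"
        using p by (simp add: field_simps power2_eq_square)
      then have "c * (\<rho> x0 * (\<xi> (x k))\<^sup>2) \<le> c * ((1/2) * (norm (gradient f (x k)))\<^sup>2)"
        using c by (intro mult_left_mono) simp_all
      moreover have "\<rho> x0 * c * (\<xi> (x k))\<^sup>2 = c * (\<rho> x0 * (\<xi> (x k))\<^sup>2)" by simp
      ultimately show "\<xi> (x (Suc k)) \<le> \<xi> (x k) - \<rho> x0 * c * (\<xi> (x k))\<^sup>2"
        using dec[OF k] by linarith
    qed (use pos \<rho> c K assms(11) in auto)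
  qed (use assms(11) in simp)
  have cc: "\<xi> (x K) \<le> \<epsilon>"
    if K: "ereal (real K) \<ge> ereal (\<xi> x0 / (c * \<epsilon>)) * elog (\<xi> x0 / \<epsilon>)"
      and large: "\<And>k. k < K \<Longrightarrow> (1/2) * (norm (gradient f (x k)))\<^sup>2 > \<epsilon>"
  proof (cases "\<xi> x0 = 0")
    case True
    then show ?thesis using mono[of 0 K] assms(7,11) by simp
  next
    case False
    then have pos: "0 < \<xi> x0" using nonneg[of x0] by simp
    show ?thesis
    \<comment> \<open>With all gradients large, each step loses at least
      \<open>c * \<epsilon>\<close>. As \<open>\<xi> (x k) \<le> \<xi> x0\<close>, this fixed loss
      is at least the fraction \<open>q\<close> of the current gap.\<close>
    proof (rule contraction_rate[where q = "c * \<epsilon> / \<xi> x0" and e = "\<lambda>k. \<xi> (x k)"])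
      fix k assume k: "k < K"
      have "\<xi> (x (Suc k)) \<le> \<xi> (x k) - c * \<epsilon>"
        using dec[OF k] mult_strict_left_mono[OF large[OF k] c] by simp
      moreover have "c * \<epsilon> / \<xi> x0 * \<xi> (x k) \<le> c * \<epsilon> / \<xi> x0 * \<xi> x0"
        using mono[of 0 k] k assms(7,11) c pos by (intro mult_left_mono) auto
      ultimately show "\<xi> (x (Suc k)) \<le> (1 - c * \<epsilon> / \<xi> x0) * \<xi> (x k)"
        using pos by (simp add: algebra_simps)
    qed (use pos c nonneg K assms(7,11) in auto)
  qed
  show ?thesis
  proof (intro conjI allI impI; (elim conjE)?)
    fix \<mu> :: real
    assume "\<mu> > 0" "\<forall>z. (1/2) * (norm (gradient f z))\<^sup>2 \<ge> \<mu> * \<xi> z"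
      "ereal (real K) \<ge> ereal (1 / (\<mu> * c)) * elog (\<xi> x0 / \<epsilon>)"
    then show "\<xi> (x K) \<le> \<epsilon>" by (intro a) blast+
  next
    fix \<rho> :: "real^'n \<Rightarrow> real"
    assume "\<forall>z. \<rho> z > 0"
      and "\<forall>z y. z \<in> UNIV - argmin_set f \<and> y \<in> UNIV - argmin_set f \<and> \<xi> z \<le> \<xi> y \<longrightarrow>
           (norm (gradient f z))\<^sup>2 / (2 * \<xi> z) \<ge> \<rho> y * \<xi> z"
      and "real K \<ge> 1 / (\<rho> x0 * c * \<epsilon>)"
    then show "\<xi> (x K) \<le> \<epsilon>" by (intro b) blast+
  next
    assume "ereal (real K) \<ge> ereal (\<xi> x0 / (c * \<epsilon>)) * elog (\<xi> x0 / \<epsilon>)"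
    then show "\<xi> (x K) \<le> \<epsilon> \<or> (\<exists>k<K. (1/2) * (norm (gradient f (x k)))\<^sup>2 \<le> \<epsilon>)"
      using cc not_le by blast
  qed
qed

end
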